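(* Let $\mathcal{X}=\{\vec{x}_1,\dots,\vec{x}_N\}$ and $\mathcal{Y}$ be finite sets of points on the unit hypersphere of $\mathbb{R}^d$. Let $\vec{v}\in\mathbb{R}^d$ be a vector orthogonal to the affine subspace containing $\mathcal{X}$, i.e. $\vec{v}^T(\vec{x}_i-\vec{x}_j)=0$ for all $i,j$. Then for every $\alpha\in\mathbb{R}$, translating all embeddings of $\mathcal{X}$ by $\alpha\vec{v}$, i.e. replacing $\vec{x}_i$ by $\vec{x}_i+\alpha\vec{v}$ for all $i$, does not change the nearest neighbor of $\vec{y}$ in $\mathcal{X}$ for any $\vec{y}\in\mathcal{Y}$.
   Context: The nearest neighbor of a point $\vec{y}\in\mathbb{R}^d$ in a finite set $\mathcal{X}\subset\mathbb{R}^d$ is $\mathrm{NN}(\vec{y},\mathcal{X})=\arg\min_{\vec{x}\in\mathcal{X}}\|\vec{x}-\vec{y}\|^2$. "Does not change" means that the index $i$ attaining the minimum for the translated set $\{\vec{x}_i+\alpha\vec{v}\}$ is the same as for the original set $\{\vec{x}_i\}$. *)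

theory Defs
  imports "HOL-Analysis.Analysis"
begin

text \<open>The arg min is taken to be the set of all minimisers, so that ties are
  not resolved by an arbitrary choice.\<close>

definition NN :: "real ^ 'd \<Rightarrow> (real ^ 'd) set \<Rightarrow> (real ^ 'd) set" where
  "NN y X = {p. is_arg_min (\<lambda>x. (norm (x - y))\<^sup>2) (\<lambda>x. x \<in> X) p}"

text \<open>The positions in an enumeration \<open>x 1, \<dots>, x N\<close> of a finite set at which a nearest
  neighbor of \<open>y\<close> occurs; this allows the nearest neighbor in a set and in a
  translate of it to be compared.\<close>

definition NN_index :: "real ^ 'd \<Rightarrow> (nat \<Rightarrow> real ^ 'd) \<Rightarrow> nat \<Rightarrow> nat set" where
  "NN_index y x N = {i \<in> {1..N}. x i \<in> NN y (x ` {1..N})}"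

end

theory Submission
  imports Defs
begin

text \<open>Expanding the square, translation by \<open>\<alpha> *\<^sub>R v\<close> adds 2 \<alpha>
  (v \<bullet> (x i - y)) + \<alpha>^2 |v|^2 to the squared distance from \<open>x i\<close> to
  \<open>y\<close>. By orthogonality v \<bullet> x i is the same for all i, so all squared distances
  shift by one common amount. Their order, hence the set of minimising indices, is
  preserved.\<close>

lemma NN_index_iff:
  "i \<in> NN_index y x N \<longleftrightarrow>
    i \<in> {1..N} \<and> (\<forall>j\<in>{1..N}. (norm (x i - y))\<^sup>2 \<le> (norm (x j - y))\<^sup>2)"
  by (auto simp: NN_index_def NN_def is_arg_min_def not_less)

text \<open>Taking differences cancels the common shift, so it need not be named: the only cross
  term that survives is 2 \<alpha> (v \<bullet> (a - b)), which vanishes.\<close>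

lemma norm_diff_translate_orthogonal:
  fixes a b v y :: "'a::real_inner"
  assumes "v \<bullet> (a - b) = 0"
  shows "(norm (a + \<alpha> *\<^sub>R v - y))\<^sup>2 - (norm (b + \<alpha> *\<^sub>R v - y))\<^sup>2
    = (norm (a - y))\<^sup>2 - (norm (b - y))\<^sup>2"
proof -
  have "v \<bullet> a = v \<bullet> b"
    using assms by (simp add: inner_diff_right)
  then show ?thesis
    by (simp add: power2_norm_eq_inner inner_simps inner_commute algebra_simps)
qed

theorem theorem3p5:
  fixes x :: "nat \<Rightarrow> real ^ 'd" and N :: nat
    and Y :: "(real ^ 'd) set" and v :: "real ^ 'd"
  assumes X_sphere: "x ` {1..N} \<subseteq> sphere 0 1"
    and Y_finite: "finite Y"
    and Y_sphere: "Y \<subseteq> sphere 0 1"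
    and orth: "\<forall>i\<in>{1..N}. \<forall>j\<in>{1..N}. v \<bullet> (x i - x j) = 0"
  shows "\<forall>\<alpha>::real. \<forall>y\<in>Y. NN_index y (\<lambda>i. x i + \<alpha> *\<^sub>R v) N = NN_index y x N"
proof (intro allI ballI)
  fix \<alpha> :: real and y
  \<comment> \<open>Equal differences have equal sign, so each pairwise comparison in
    \<open>NN_index_iff\<close> is unaffected.\<close>
  have "(norm (x i + \<alpha> *\<^sub>R v - y))\<^sup>2 \<le> (norm (x j + \<alpha> *\<^sub>R v - y))\<^sup>2
      \<longleftrightarrow> (norm (x i - y))\<^sup>2 \<le> (norm (x j - y))\<^sup>2"
    if "i \<in> {1..N}" "j \<in> {1..N}" for i j
    using norm_diff_translate_orthogonal[of v "x i" "x j" \<alpha> y] orth that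
    by (smt (verit))
  then show "NN_index y (\<lambda>i. x i + \<alpha> *\<^sub>R v) N = NN_index y x N"
    unfolding set_eq_iff NN_index_iff by blast
qed

end
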